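(* Let $d\in\mathbb{N}$, $d\ge 1$, $p\in(1,\infty)$ and $m>0$ satisfy $m(p-1)>1$ and $dp>d+1$. Let $o\in\mathbb{R}^d$. For every $R>0$, every $x\in B_R(o)$, and every probabilistically weak solution $X$ (as defined in the context) starting at $x$, the exit time $\tau_R:=\inf\{t\ge0:X_t\notin B_R(o)\}$ satisfies $$\tau_R\ge\rho^{-\beta}\,\big[R-|x-o|\big]^\beta\qquad\mathbf{P}^x\text{-a.s.}$$
   Context: $B_R(o)$ is the open Euclidean ball of radius $R$ and center $o$. Parameters: $\beta:=p+d(m(p-1)-1)$, $\gamma:=\frac{p-1}{m(p-1)-1}$, $\kappa:=\frac{m(p-1)-1}{mp}\beta^{-1/(p-1)}$, all positive. $\omega_{d-1}$ is the area of the unit sphere in $\mathbb{R}^d$ ($\omega_0=2$). Barenblatt profile: for $t>0$, $r\ge 0$, $S(t,r):=C-\kappa[t^{-1/\beta}r]^{p/(p-1)}$ and $U(t,r):=t^{-d/\beta}\,\max\{S(t,r),0\}^\gamma$, where $C>0$ is the unique constant (depending only on $d,p,m$) such that $\omega_{d-1}\int_0^\infty U(t,r)r^{d-1}\,\mathrm{d}r=1$ for every $t>0$. Put $\rho:=(C/\kappa)^{(p-1)/p}$; the support of $U(t,\cdot)$ is $[0,\rho t^{1/\beta}]$. The Barenblatt solution is $w^x(t,y):=U(t,|y-x|)$. Coefficients: for $0<r<\rho t^{1/\beta}$ let $a(t,r):=m^{p-1}|\partial_rU(t,r)|^{p-2}U(t,r)^{(m-1)(p-1)}$ and $a_r:=\partial_r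 a$; set $a(t,r):=a_r(t,r):=0$ for $r\ge\rho t^{1/\beta}$ and for $r=0$. For $z\in\mathbb{R}^d$, $\mathrm{sgn}\,z:=z/|z|$ if $z\ne0$, $\mathrm{sgn}\,0:=0$. A stochastic basis is a complete probability space $(\Omega,\mathscr{F},\mathbf{P}^x)$ with a right-continuous filtration $\mathscr{F}_\bullet$ augmented by null sets; $\mathbf{E}^x$ denotes expectation. A probabilistically weak solution starting at $x\in\mathbb{R}^d$ is a continuous $\mathscr{F}_\bullet$-adapted $\mathbb{R}^d$-valued process $X$ on a stochastic basis carrying a standard $d$-dimensional $\mathscr{F}_\bullet$-Brownian motion $W$ such that (a) $\mathbf{E}^x[\int_0^t a(s,|X_s-x|)\,\mathrm{d}s]<\infty$ and $\mathbf{E}^x[\int_0^t|a_r(s,|X_s-x|)|\,\mathrm{d}s]<\infty$ for every $t>0$; (b) $\mathbf{P}^x$-a.s., for all $t\ge0$, $X_t=X_0+\int_0^t\sqrt{2a(s,|X_s-x|)}\,\mathrm{d}W_s+\int_0^t a_r(s,|X_s-x|)\,\mathrm{sgn}(X_s-x)\,\mathrm{d}s$; (c) for every $t>0$ the law of $X_t$ is $w^x(t,\cdot)\,\mathscr{L}^d$ ($\mathscr{L}^d$ Lebesgue measure); consequently $X_0=x$ a.s. *)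

theory Defs
  imports "HOL-Probability.Probability"
begin

section \<open>Barenblatt profile\<close>

definition bb_beta :: "nat \<Rightarrow> real \<Rightarrow> real \<Rightarrow> real" where
  "bb_beta d p m = p + real d * (m * (p - 1) - 1)"

definition bb_gamma :: "real \<Rightarrow> real \<Rightarrow> real" where
  "bb_gamma p m = (p - 1) / (m * (p - 1) - 1)"

definition bb_kappa :: "nat \<Rightarrow> real \<Rightarrow> real \<Rightarrow> real" where
  "bb_kappa d p m = (m * (p - 1) - 1) / (m * p) * bb_beta d p m powr (- 1 / (p - 1))"

text \<open>Area of the unit sphere of a \<open>d\<close>-dimensional Euclidean space, that is, the quantity
  usually written with index \<open>d - 1\<close>.\<close>

definition sphere_area :: "nat \<Rightarrow> real" where
  "sphere_area d = 2 * pi powr (real d / 2) / Gamma (real d / 2)"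

lemma sphere_area_1: "sphere_area 1 = 2"
  by (simp add: sphere_area_def Gamma_one_half_real powr_half_sqrt)

lemma sphere_area_eq_unit_ball_vol:
  assumes "d \<ge> 1"
  shows "sphere_area d = real d * unit_ball_vol (real d)"
proof -
  have *: "Gamma (real d / 2 + 1) = real d / 2 * Gamma (real d / 2)"
    using assms by (intro Gamma_plus1) auto
  show ?thesis using assms
    unfolding sphere_area_def unit_ball_vol_def * by (simp add: field_simps)
qed

definition bb_profile :: "nat \<Rightarrow> real \<Rightarrow> real \<Rightarrow> real \<Rightarrow> real \<Rightarrow> real \<Rightarrow> real" where
  "bb_profile d p m C t r =
     t powr (- real d / bb_beta d p m) *
     max (C - bb_kappa d p m * (t powr (- 1 / bb_beta d p m) * r) powr (p / (p - 1))) 0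
       powr bb_gamma p m"

definition bb_C :: "nat \<Rightarrow> real \<Rightarrow> real \<Rightarrow> real" where
  "bb_C d p m = (THE C. C > 0 \<and>
     (\<forall>t>0. sphere_area d *
        (LINT r:{0..}|lborel. bb_profile d p m C t r * r ^ (d - 1)) = 1))"

definition bb_U :: "nat \<Rightarrow> real \<Rightarrow> real \<Rightarrow> real \<Rightarrow> real \<Rightarrow> real" where
  "bb_U d p m = bb_profile d p m (bb_C d p m)"

definition bb_rho :: "nat \<Rightarrow> real \<Rightarrow> real \<Rightarrow> real" where
  "bb_rho d p m = (bb_C d p m / bb_kappa d p m) powr ((p - 1) / p)"

definition barenblatt :: "real \<Rightarrow> real \<Rightarrow> real ^ 'n \<Rightarrow> real \<Rightarrow> real ^ 'n \<Rightarrow> real" where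
  "barenblatt p m x t y = bb_U CARD('n) p m t (norm (y - x))"

section \<open>Coefficients\<close>

text \<open>At \<open>t = 0\<close> the condition \<open>0 < r < \<rho> t\<^sup>1\<^sup>/\<^sup>\<beta>\<close> is never satisfied, as
  \<open>0 powr s = 0\<close>; hence both coefficients vanish there.\<close>

definition coeff_a :: "nat \<Rightarrow> real \<Rightarrow> real \<Rightarrow> real \<Rightarrow> real \<Rightarrow> real" where
  "coeff_a d p m t r =
     (if 0 < r \<and> r < bb_rho d p m * t powr (1 / bb_beta d p m)
      then m powr (p - 1) * \<bar>deriv (\<lambda>s. bb_U d p m t s) r\<bar> powr (p - 2)
             * bb_U d p m t r powr ((m - 1) * (p - 1))
      else 0)"

definition coeff_a_r :: "nat \<Rightarrow> real \<Rightarrow> real \<Rightarrow> real \<Rightarrow> real \<Rightarrow> real" where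
  "coeff_a_r d p m t r =
     (if 0 < r \<and> r < bb_rho d p m * t powr (1 / bb_beta d p m)
      then deriv (\<lambda>s. coeff_a d p m t s) r else 0)"

section \<open>Stochastic bases and Brownian motion\<close>

text \<open>Time is the half-line \<open>[0, \<infinity>)\<close>; values of filtrations and processes at negative
  times are irrelevant.\<close>

locale stochastic_basis = prob_space M + complete_measure M
  for M :: "'w measure" +
  fixes F :: "real \<Rightarrow> 'w measure"
  assumes subalgebra_F: "\<And>t. 0 \<le> t \<Longrightarrow> subalgebra M (F t)"
    and F_mono: "\<And>s t. 0 \<le> s \<Longrightarrow> s \<le> t \<Longrightarrow> sets (F s) \<subseteq> sets (F t)"
    and F_right_continuous: "\<And>t. 0 \<le> t \<Longrightarrow> sets (F t) = (\<Inter>u\<in>{t<..}. sets (F u))"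
    and F_null_sets: "null_sets M \<subseteq> sets (F 0)"

definition adapted_process ::
    "(real \<Rightarrow> 'w measure) \<Rightarrow> (real \<Rightarrow> 'w \<Rightarrow> real ^ 'n) \<Rightarrow> bool" where
  "adapted_process F X \<longleftrightarrow> (\<forall>t\<ge>0. X t \<in> borel_measurable (F t))"

definition continuous_process ::
    "'w measure \<Rightarrow> (real \<Rightarrow> 'w \<Rightarrow> real ^ 'n) \<Rightarrow> bool" where
  "continuous_process M X \<longleftrightarrow> (AE \<omega> in M. continuous_on {0..} (\<lambda>t. X t \<omega>))"

locale brownian_basis = stochastic_basis M F
  for M :: "'w measure" and F :: "real \<Rightarrow> 'w measure" +
  fixes W :: "real \<Rightarrow> 'w \<Rightarrow> real ^ 'n"
  assumes W_adapted: "adapted_process F W"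
    and W_continuous: "continuous_process M W"
    and W_zero: "AE \<omega> in M. W 0 \<omega> = 0"
    and W_indep_increments: "\<And>s t. 0 \<le> s \<Longrightarrow> s < t \<Longrightarrow>
      indep_set (sets (F s))
        (sets (vimage_algebra (space M) (\<lambda>\<omega>. W t \<omega> - W s \<omega>) borel))"
    and W_gaussian_increments: "\<And>s t. 0 \<le> s \<Longrightarrow> s < t \<Longrightarrow>
      distributed M lborel (\<lambda>\<omega>. W t \<omega> - W s \<omega>)
        (\<lambda>z. ennreal (\<Prod>i\<in>UNIV. normal_density 0 (sqrt (t - s)) (z $ i)))"

section \<open>Ito integral\<close>

text \<open>A list entry \<open>(u, v, \<xi>)\<close> stands for the elementary integrand
  \<open>\<xi> 1\<^bsub>(u, v]\<^esub>\<close> with \<open>\<xi>\<close> bounded and measurable at time \<open>u\<close>;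
  the list stands for the sum of its entries.\<close>

type_synonym 'w simple_integrand = "(real \<times> real \<times> ('w \<Rightarrow> real)) list"

definition simple_integrand ::
    "'w measure \<Rightarrow> (real \<Rightarrow> 'w measure) \<Rightarrow> 'w simple_integrand \<Rightarrow> bool" where
  "simple_integrand M F h \<longleftrightarrow>
     (\<forall>(u, v, \<xi>) \<in> set h. 0 \<le> u \<and> u \<le> v \<and> \<xi> \<in> borel_measurable (F u) \<and>
        (\<exists>K. \<forall>\<omega>\<in>space M. \<bar>\<xi> \<omega>\<bar> \<le> K))"

definition simple_value :: "'w simple_integrand \<Rightarrow> real \<Rightarrow> 'w \<Rightarrow> real" where
  "simple_value h s \<omega> = (\<Sum>(u, v, \<xi>)\<leftarrow>h. \<xi> \<omega> * indicator {u<..v} s)"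

definition simple_ito ::
    "(real \<Rightarrow> 'w \<Rightarrow> real ^ 'n) \<Rightarrow> 'w simple_integrand \<Rightarrow> real \<Rightarrow> 'w \<Rightarrow> real ^ 'n" where
  "simple_ito W h t \<omega> = (\<Sum>(u, v, \<xi>)\<leftarrow>h. \<xi> \<omega> *\<^sub>R (W (min t v) \<omega> - W (min t u) \<omega>))"

text \<open>\<open>I\<close> is a version of the process \<open>t \<mapsto> \<integral>\<^sub>0\<^sup>t H\<^sub>s dW\<^sub>s\<close>, for a scalar
  integrand \<open>H\<close> with \<open>E \<integral>\<^sub>0\<^sup>T H\<^sub>s\<^sup>2 ds < \<infinity>\<close> for all \<open>T\<close>: the continuous adapted process
  obtained by extending the integral of simple integrands along the Ito isometry. It is
  determined by \<open>H\<close> and \<open>W\<close> up to indistinguishability. Approximability of \<open>H\<close> by simple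
  integrands is part of the definition.\<close>

definition is_ito_integral ::
    "'w measure \<Rightarrow> (real \<Rightarrow> 'w measure) \<Rightarrow> (real \<Rightarrow> 'w \<Rightarrow> real ^ 'n) \<Rightarrow>
     (real \<Rightarrow> 'w \<Rightarrow> real) \<Rightarrow> (real \<Rightarrow> 'w \<Rightarrow> real ^ 'n) \<Rightarrow> bool" where
  "is_ito_integral M F W H I \<longleftrightarrow>
     adapted_process F I \<and> continuous_process M I \<and>
     (\<exists>h. (\<forall>k. simple_integrand M F (h k)) \<and>
       (\<forall>T\<ge>0. (\<lambda>k. \<integral>\<^sup>+\<omega>. (\<integral>\<^sup>+s\<in>{0..T}. ennreal ((simple_value (h k) s \<omega> - H s \<omega>)\<^sup>2) \<partial>lborel) \<partial>M)
               \<longlonglongrightarrow> 0) \<and>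
       (\<forall>T\<ge>0. (\<lambda>k. \<integral>\<^sup>+\<omega>. ennreal ((norm (simple_ito W (h k) T \<omega> - I T \<omega>))\<^sup>2) \<partial>M)
               \<longlonglongrightarrow> 0))"

section \<open>Probabilistically weak solutions\<close>

text \<open>By condition \<open>weak_a\<close> the integrand \<open>sqrt (2 a)\<close> is square integrable over
  \<open>[0, t] \<times> \<Omega>\<close>, so that \<open>is_ito_integral\<close> is the full Ito integral here.
  That \<open>X 0 = x\<close> almost surely is a consequence of \<open>weak_law\<close> and path continuity.\<close>

locale weak_solution = brownian_basis M F W
  for M :: "'w measure" and F :: "real \<Rightarrow> 'w measure" and W :: "real \<Rightarrow> 'w \<Rightarrow> real ^ 'n" +
  fixes p m :: real and x :: "real ^ 'n" and X :: "real \<Rightarrow> 'w \<Rightarrow> real ^ 'n"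
  assumes X_adapted: "adapted_process F X"
    and X_continuous: "continuous_process M X"
    and weak_a: "\<And>t. t > 0 \<Longrightarrow>
      (\<integral>\<^sup>+\<omega>. (\<integral>\<^sup>+s\<in>{0..t}. ennreal (coeff_a CARD('n) p m s (norm (X s \<omega> - x))) \<partial>lborel) \<partial>M) < \<infinity>"
    and weak_a_r: "\<And>t. t > 0 \<Longrightarrow>
      (\<integral>\<^sup>+\<omega>. (\<integral>\<^sup>+s\<in>{0..t}. ennreal \<bar>coeff_a_r CARD('n) p m s (norm (X s \<omega> - x))\<bar> \<partial>lborel) \<partial>M) < \<infinity>"
    and weak_sde: "\<exists>I. is_ito_integral M F W
        (\<lambda>s \<omega>. sqrt (2 * coeff_a CARD('n) p m s (norm (X s \<omega> - x)))) I \<and>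
      (AE \<omega> in M. \<forall>t\<ge>0. X t \<omega> = X 0 \<omega> + I t \<omega> +
        (LINT s:{0..t}|lborel. coeff_a_r CARD('n) p m s (norm (X s \<omega> - x)) *\<^sub>R sgn (X s \<omega> - x)))"
    and weak_law: "\<And>t. t > 0 \<Longrightarrow>
      distr M borel (X t) = density lborel (\<lambda>y. ennreal (barenblatt p m x t y))"

definition exit_time :: "(real \<Rightarrow> 'w \<Rightarrow> real ^ 'n) \<Rightarrow> (real ^ 'n) set \<Rightarrow> 'w \<Rightarrow> ereal" where
  "exit_time X B \<omega> = (INF t\<in>{t. 0 \<le> t \<and> X t \<omega> \<notin> B}. ereal t)"

end

theory Submission
  imports Defs
begin

text \<open>At every rational time the law of \<open>X\<close> is carried by the ball around \<open>x\<close> of radius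
  \<open>\<rho> t\<^sup>1\<^sup>/\<^sup>\<beta>\<close>, the support of the Barenblatt solution. By path continuity this holds almost
  surely for all times at once, so leaving \<open>B\<^sub>R\<close>, which requires travelling at least
  \<open>R - |x - z|\<close>, takes the time at which the support has grown to that size.\<close>

lemma bb_beta_pos:
  assumes "p > 1" "m * (p - 1) > 1"
  shows "bb_beta d p m > 0"
  unfolding bb_beta_def using assms by (intro add_pos_nonneg mult_nonneg_nonneg) auto

lemma bb_kappa_pos:
  assumes "p > 1" "m > 0" "m * (p - 1) > 1"
  shows "bb_kappa d p m > 0"
  unfolding bb_kappa_def using assms bb_beta_pos[of p m d]
  by (intro mult_pos_pos divide_pos_pos) auto

text \<open>Since \<kappa> > 0, the bracket in the profile is at most \<open>C\<close>; for
  \<open>C \<le> 0\<close> its truncation is 0, and \<open>0 powr\<close> any exponent is 0.\<close>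

lemma bb_U_nonzero_imp_C_pos:
  assumes "p > 1" "m > 0" "m * (p - 1) > 1" "bb_U d p m t r \<noteq> 0"
  shows "bb_C d p m > 0"
proof (rule ccontr)
  assume "\<not> bb_C d p m > 0"
  then have "max (bb_C d p m - bb_kappa d p m * (t powr (- 1 / bb_beta d p m) * r) powr (p / (p - 1))) 0 = 0"
    using bb_kappa_pos[of p m d] assms
    by (intro max_absorb2) (smt (verit) mult_nonneg_nonneg powr_ge_zero)
  with assms show False
    by (simp add: bb_U_def bb_profile_def)
qed

text \<open>The exponent in \<open>bb_rho\<close> is reciprocal to p/(p-1), so \<rho> is the zero of
  s \<mapsto> C - \<kappa> s^(p/(p-1)) on the positive half-line; beyond it the bracket is negative
  and gets truncated.\<close>

lemma bb_U_eq_0: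
  assumes "p > 1" "m > 0" "m * (p - 1) > 1" "bb_C d p m > 0" "t > 0"
    and r: "r > bb_rho d p m * t powr (1 / bb_beta d p m)"
  shows "bb_U d p m t r = 0"
proof -
  have k: "bb_kappa d p m > 0" using assms by (intro bb_kappa_pos)
  have e: "p / (p - 1) > 0" "(p - 1) / p * (p / (p - 1)) = 1" using \<open>p > 1\<close> by auto
  \<comment> \<open>The powers of \<open>t\<close> cancel, which turns the bound on \<open>r\<close>
    into one on the self-similar variable.\<close>
  have "bb_rho d p m = bb_rho d p m * t powr (1 / bb_beta d p m) * t powr (- 1 / bb_beta d p m)"
    using \<open>t > 0\<close> by (simp flip: powr_add add: mult.assoc)
  also have "\<dots> < t powr (- 1 / bb_beta d p m) * r"
    using r \<open>t > 0\<close> by (subst mult.commute, intro mult_strict_left_mono) auto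
  finally have "bb_rho d p m powr (p / (p - 1)) < (t powr (- 1 / bb_beta d p m) * r) powr (p / (p - 1))"
    using e by (intro powr_less_mono2) (auto simp: bb_rho_def)
  moreover have "bb_rho d p m powr (p / (p - 1)) = bb_C d p m / bb_kappa d p m"
    unfolding bb_rho_def powr_powr e using assms k by simp
  ultimately have "bb_C d p m < bb_kappa d p m * (t powr (- 1 / bb_beta d p m) * r) powr (p / (p - 1))"
    using k by (simp add: field_simps)
  then show ?thesis by (simp add: bb_U_def bb_profile_def)
qed

lemma borel_measurable_barenblatt [measurable]: "barenblatt p m x t \<in> borel_measurable borel"
  unfolding barenblatt_def bb_U_def bb_profile_def by measurable

context weak_solution
begin

lemma X_measurable: "0 \<le> t \<Longrightarrow> X t \<in> borel_measurable M"
  using X_adapted subalgebra_F measurable_from_subalg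
  unfolding adapted_process_def by blast

text \<open>Existence and uniqueness in the \<open>THE\<close> defining \<^term>\<open>bb_C\<close> are bypassed:
  \<open>C \<le> 0\<close> would make the profile vanish, while the law of \<open>X 1\<close> has mass one.\<close>

lemma bb_C_pos:
  assumes "p > 1" "m > 0" "m * (p - 1) > 1"
  shows "bb_C CARD('n) p m > 0"
proof (rule ccontr)
  assume "\<not> ?thesis"
  then have "barenblatt p m x 1 y = 0" for y
    using bb_U_nonzero_imp_C_pos[OF assms] unfolding barenblatt_def by blast
  then have "emeasure (distr M borel (X 1)) UNIV = 0"
    by (simp add: weak_law emeasure_density)
  moreover have "emeasure (distr M borel (X 1)) UNIV = 1"
    using X_measurable[of 1] by (simp add: emeasure_distr emeasure_space_1)
  ultimately show False by simp
qed

text \<open>A measure with a density does not charge the set where the density vanishes; the bound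
  is then pulled back along \<open>X t\<close>.\<close>

lemma AE_norm_le_support_radius:
  assumes "p > 1" "m > 0" "m * (p - 1) > 1" "t > 0"
  shows "AE \<omega> in M. norm (X t \<omega> - x) \<le> bb_rho CARD('n) p m * t powr (1 / bb_beta CARD('n) p m)"
proof -
  let ?b = "bb_rho CARD('n) p m * t powr (1 / bb_beta CARD('n) p m)"
  have "norm (y - x) \<le> ?b" if "barenblatt p m x t y > 0" for y
    using bb_U_eq_0[of p m "CARD('n)" t "norm (y - x)"] assms bb_C_pos that unfolding barenblatt_def
    by linarith
  then have "AE y in density lborel (\<lambda>y. ennreal (barenblatt p m x t y)). norm (y - x) \<le> ?b"
    by (subst AE_density) auto
  then have "AE y in distr M borel (X t). norm (y - x) \<le> ?b"
    by (simp only: weak_law \<open>t > 0\<close>)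
  then show ?thesis
    using X_measurable[of t] \<open>t > 0\<close> by (subst (asm) AE_distr_iff) auto
qed

lemma AE_norm_le_support_radius_all_times:
  assumes "p > 1" "m > 0" "m * (p - 1) > 1"
  shows "AE \<omega> in M. \<forall>t\<ge>0.
    norm (X t \<omega> - x) \<le> bb_rho CARD('n) p m * t powr (1 / bb_beta CARD('n) p m)"
proof -
  let ?b = "\<lambda>t::real. bb_rho CARD('n) p m * t powr (1 / bb_beta CARD('n) p m)"
  \<comment> \<open>The law is prescribed at positive times only, hence 0 is left out here.\<close>
  have "AE \<omega> in M. \<forall>t\<in>{0<..} \<inter> \<rat>. norm (X t \<omega> - x) \<le> ?b t"
    by (intro AE_ball_countable') (use assms countable_rat AE_norm_le_support_radius in auto)
  with X_continuous[unfolded continuous_process_def] show ?thesis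
  proof eventually_elim
    fix \<omega>
    assume cont: "continuous_on {0..} (\<lambda>t. X t \<omega>)"
      and le: "\<forall>t\<in>{0<..} \<inter> \<rat>. norm (X t \<omega> - x) \<le> ?b t"
    \<comment> \<open>Continuity at 0 rests on the exponent 1/\<beta> being positive.\<close>
    have "continuous_on {0..} ?b"
      using bb_beta_pos[OF assms(1,3)]
      by (auto intro!: continuous_on_mult_left continuous_on_powr' continuous_on_const continuous_on_id)
    with cont have "continuous_on {0..} (\<lambda>t. ?b t - norm (X t \<omega> - x))"
      by (intro continuous_on_diff continuous_on_norm continuous_on_const)
    \<comment> \<open>The closure regains t = 0, where the bound says that the path starts at
      \<open>x\<close>.\<close>
    moreover have "closure ({0<..} \<inter> \<rat>) = {0::real..}"
      by (subst closure_open_Int_superset) (auto simp: Rats_closure_real)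
    ultimately have "\<forall>t\<in>{0..}. ?b t - norm (X t \<omega> - x) \<ge> 0"
      using le continuous_ge_on_closure[of "{0<..} \<inter> \<rat>" "\<lambda>t. ?b t - norm (X t \<omega> - x)" _ 0]
      by auto
    then show "\<forall>t\<ge>0. norm (X t \<omega> - x) \<le> ?b t" by simp
  qed
qed

end

theorem proposition3p18:
  fixes p m R :: real and z x :: "real ^ 'n"
    and M :: "'w measure" and F :: "real \<Rightarrow> 'w measure"
    and W X :: "real \<Rightarrow> 'w \<Rightarrow> real ^ 'n"
  assumes "p > 1" and "m > 0" and "m * (p - 1) > 1"
    and "real CARD('n) * p > real CARD('n) + 1"
    and "R > 0" and "x \<in> ball z R"
    and "weak_solution M F W p m x X"
  shows "AE \<omega> in M.
    ereal (bb_rho CARD('n) p m powr (- bb_beta CARD('n) p m) *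
           (R - norm (x - z)) powr bb_beta CARD('n) p m)
      \<le> exit_time X (ball z R) \<omega>"
proof -
  interpret weak_solution M F W p m x X by fact
  define \<rho> where "\<rho> = bb_rho CARD('n) p m"
  define \<beta> where "\<beta> = bb_beta CARD('n) p m"
  have \<rho>: "\<rho> > 0"
    using bb_C_pos bb_kappa_pos[of p m "CARD('n)"] assms by (simp add: \<rho>_def bb_rho_def)
  have \<beta>: "\<beta> > 0" unfolding \<beta>_def using assms by (intro bb_beta_pos)
  have gap: "R - norm (x - z) > 0"
    using assms(6) by (simp add: dist_norm norm_minus_commute)
  have "AE \<omega> in M. \<forall>t\<ge>0. norm (X t \<omega> - x) \<le> \<rho> * t powr (1 / \<beta>)"
    unfolding \<rho>_def \<beta>_def using assms by (intro AE_norm_le_support_radius_all_times)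
  then show ?thesis unfolding \<rho>_def[symmetric] \<beta>_def[symmetric]
  proof eventually_elim
    fix \<omega>
    assume le: "\<forall>t\<ge>0. norm (X t \<omega> - x) \<le> \<rho> * t powr (1 / \<beta>)"
    \<comment> \<open>A bound for each time spent outside the ball passes to the infimum; for a path
      that never leaves, the infimum in \<open>ereal\<close> is \<infinity>.\<close>
    have "\<rho> powr - \<beta> * (R - norm (x - z)) powr \<beta> \<le> t"
      if t: "0 \<le> t" "X t \<omega> \<notin> ball z R" for t
    proof -
      have "R \<le> norm (X t \<omega> - z)" using t by (simp add: dist_norm norm_minus_commute)
      also have "\<dots> \<le> norm (X t \<omega> - x) + norm (x - z)"
        using norm_triangle_ineq[of "X t \<omega> - x" "x - z"] by simp
      finally have "R - norm (x - z) \<le> \<rho> * t powr (1 / \<beta>)"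
        using le t by force
      \<comment> \<open>Raising to the power \<beta> preserves the order for nonnegative bases;
        \<open>gap\<close> provides this.\<close>
      then have "(R - norm (x - z)) powr \<beta> \<le> (\<rho> * t powr (1 / \<beta>)) powr \<beta>"
        using gap \<beta> by (intro powr_mono2) auto
      also have "\<dots> = \<rho> powr \<beta> * t"
        using \<rho> \<beta> t by (simp add: powr_mult powr_powr)
      finally show ?thesis
        using \<rho> by (simp add: powr_minus field_simps)
    qed
    then show "ereal (\<rho> powr - \<beta> * (R - norm (x - z)) powr \<beta>) \<le> exit_time X (ball z R) \<omega>"
      unfolding exit_time_def by (intro INF_greatest) auto
  qed
qed

end
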